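(* Let $q$ be an odd prime power and let $\gamma\in\mathbb{F}_{q^2}$. The polynomial $f(x)=x+\gamma\,\mathrm{Tr}\left(x^{q+3}+x^{2q+2}\right)$ over $\mathbb{F}_{q^2}$ is a permutation polynomial if and only if $\gamma=0$.
   Context: $\mathrm{Tr}:\mathbb{F}_{q^2}\to\mathbb{F}_q$ is the trace map $\mathrm{Tr}(x)=x+x^q$. A polynomial $f$ over $\mathbb{F}_{q^2}$ is a permutation polynomial if the map $x\mapsto f(x)$ is a bijection of $\mathbb{F}_{q^2}$ onto itself. *)

theory Defs
  imports
    "HOL-Library.Cardinality"
    "HOL-Computational_Algebra.Computational_Algebra"
    "HOL-Number_Theory.Prime_Powers"
begin

text \<open>
  The trace \<open>Tr(x) = x + x\<^sup>q\<close> from the field with \<open>q\<^sup>2\<close> elements to its subfield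
  with \<open>q\<close> elements. It is stated for an arbitrary commutative ring so that the same
  expression can also be formed in the polynomial ring; the two readings agree under evaluation.
\<close>

definition Tr :: "nat \<Rightarrow> 'a::comm_ring_1 \<Rightarrow> 'a" where
  "Tr q x = x + x ^ q"

lemma poly_Tr: "poly (Tr q p) x = Tr q (poly p x)"
  by (simp add: Tr_def)

definition permutation_poly :: "'a::field poly \<Rightarrow> bool" where
  "permutation_poly f \<longleftrightarrow> bij (poly f)"

end

theory Submission
  imports Defs
begin

text \<open>
  Writing \<open>N(x) = x\<^bsup>q+1\<^esup>\<close>, the polynomial is the map \<open>x + \<gamma> N(x) Tr(x)\<^sup>2\<close>, so it preserves
  every line in direction \<open>\<gamma>\<close> over the subfield of \<open>q\<close> elements and acts on it
  as a polynomial of degree at most four. For \<open>\<gamma> \<noteq> 0\<close> two points with the same image can be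
  written down on a suitable line. If \<open>\<gamma>\<close> is in the subfield, such a line is
  found by representing a nonzero element by a binary quadratic form, which is the norm form
  when 2 is a square in the subfield and hyperbolic otherwise.
\<close>

section \<open>Characteristic and power residues in a finite field\<close>

lemma CHAR_dvd_CARD: "CHAR('a::finite_field) dvd CARD('a)"
proof -
  \<comment> \<open>Translation by 1 permutes the field, so adding 1 to every summand leaves the
    total unchanged.\<close>
  have "(\<Sum>x\<in>(UNIV :: 'a set). x + 1) = (\<Sum>x\<in>UNIV. x)"
    by (rule sum.reindex_bij_witness[of _ "\<lambda>x. x - 1" "\<lambda>x. x + 1"]) auto
  then have "(of_nat CARD('a) :: 'a) = 0"
    by (simp add: sum.distrib)
  then show ?thesis
    by (simp only: of_nat_eq_0_iff_char_dvd)
qed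

lemma card_power_eq_le:
  fixes y :: "'a::idom"
  assumes "d > 0"
  shows "card {x. x ^ d = y} \<le> d"
proof -
  define p where "p = monom 1 d - [:y:]"
  have "coeff p d = 1"
    using assms by (cases d) (auto simp: p_def)
  then have "p \<noteq> 0"
    by auto
  have "{x. x ^ d = y} = {x. poly p x = 0}"
    by (simp add: p_def poly_monom)
  also have "card \<dots> \<le> degree p"
    by (rule card_poly_roots_bound) fact
  also have "degree p \<le> d"
    unfolding p_def by (rule degree_diff_le) (auto simp: degree_monom_le)
  finally show ?thesis .
qed

text \<open>Counting: the \<open>d\<close>-th power map on the \<open>d * e\<close> nonzero elements
  has fibres of size at most \<open>d\<close>, so its image has at least \<open>e\<close> elements.
  The image lies among the roots of \<open>z ^ e = 1\<close>, of which there are at most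
  \<open>e\<close>, so it is all of them.\<close>

lemma finite_field_power_residue:
  fixes y :: "'a::finite_field"
  assumes card: "CARD('a) = Suc (d * e)" and y: "y ^ e = 1"
  shows "\<exists>x. x ^ d = y"
proof -
  define U where "U = (UNIV - {0} :: 'a set)"
  define R where "R = {z::'a. z ^ e = 1}"
  have card_U: "card U = d * e"
    by (simp add: U_def card)
  have "1 \<in> U"
    by (simp add: U_def)
  then have "card U > 0"
    by (auto simp: card_gt_0_iff)
  then have pos: "d > 0" "e > 0"
    using card_U by auto
  have img: "(\<lambda>x. x ^ d) ` U \<subseteq> R"
  proof safe
    fix x assume "x \<in> U"
    moreover have "x * x ^ (d * e) = x"
      using finite_field_power_card_eq_same[of x] by (simp add: card)
    ultimately show "x ^ d \<in> R"
      by (simp add: U_def R_def power_mult)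
  qed
  have "U \<subseteq> (\<Union>z\<in>(\<lambda>x. x ^ d) ` U. {x. x ^ d = z})"
    by auto
  then have "card U \<le> card (\<Union>z\<in>(\<lambda>x. x ^ d) ` U. {x. x ^ d = z})"
    by (rule card_mono[rotated]) simp
  also have "\<dots> \<le> (\<Sum>z\<in>(\<lambda>x. x ^ d) ` U. card {x. x ^ d = z})"
    by (rule card_UN_le) simp
  also have "\<dots> \<le> card ((\<lambda>x. x ^ d) ` U) * d"
    using sum_bounded_above[of "(\<lambda>x. x ^ d) ` U" "\<lambda>z. card {x. x ^ d = z}" d]
    by (simp add: card_power_eq_le pos)
  finally have "e \<le> card ((\<lambda>x. x ^ d) ` U)"
    using pos by (simp add: card_U)
  moreover have "card R \<le> e"
    unfolding R_def by (rule card_power_eq_le) fact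
  ultimately have "(\<lambda>x. x ^ d) ` U = R"
    by (intro card_seteq img) auto
  moreover have "y \<in> R"
    using y by (simp add: R_def)
  ultimately show ?thesis
    by (metis imageE)
qed

section \<open>Conjugation, norms and square roots in the quadratic extension\<close>

locale odd_quadratic_field =
  fixes q :: nat and field_type :: "'a::finite_field itself"
  assumes primepow_q: "primepow q" and odd_q: "odd q" and card_field: "CARD('a) = q ^ 2"
begin

lemma q_gt_1: "q > 1"
  using primepow_gt_Suc_0[OF primepow_q] by simp

text \<open>This makes the \<open>q\<close>-th power map additive, being an iterate of
  Frobenius.\<close>

lemma q_power_of_CHAR: "\<exists>k. q = CHAR('a) ^ k"
proof -
  obtain p k where p: "prime p" "q = p ^ k"
    using primepow_q by (auto simp: primepow_def)
  have "CHAR('a) dvd (p ^ k) ^ 2"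
    using CHAR_dvd_CARD[where ?'a = 'a] by (simp add: card_field p)
  then have "CHAR('a) dvd p"
    using CHAR_prime[where ?'a = 'a] by (meson prime_dvd_power)
  then have "CHAR('a) = p"
    using CHAR_prime[where ?'a = 'a] p(1) primes_dvd_imp_eq by blast
  with p show ?thesis
    by blast
qed

lemma two_nonzero: "(2::'a) \<noteq> 0"
proof
  assume "(2::'a) = 0"
  then have "CHAR('a) dvd 2"
    using of_nat_eq_0_iff_char_dvd[where ?'a = 'a, of 2] by simp
  then have "CHAR('a) = 2"
    using CHAR_prime[where ?'a = 'a] primes_dvd_imp_eq two_is_prime_nat by blast
  moreover obtain k where "q = CHAR('a) ^ k"
    using q_power_of_CHAR by blast
  ultimately show False
    using odd_q q_gt_1 by (cases k) auto
qed

lemma frob_add: "((x::'a) + y) ^ q = x ^ q + y ^ q"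
  using q_power_of_CHAR freshmans_dream'[OF CHAR_prime] by blast

lemma frob_minus: "(- (x::'a)) ^ q = - (x ^ q)"
  using odd_q by simp

lemma frob_diff: "((x::'a) - y) ^ q = x ^ q - y ^ q"
  using frob_add[of x "- y"] frob_minus[of y] by simp

lemma frob_of_nat: "(of_nat n :: 'a) ^ q = of_nat n"
  using q_gt_1 by (induction n) (auto simp: frob_add)

lemma frob_numeral: "(numeral n :: 'a) ^ q = numeral n"
  using frob_of_nat[of "numeral n"] by simp

lemma frob_frob: "((x::'a) ^ q) ^ q = x"
  using finite_field_power_card_eq_same[of x]
  by (simp add: card_field power2_eq_square power_mult)

lemma power_commutes_exp: "((x::'a) ^ m) ^ n = (x ^ n) ^ m"
  by (simp add: mult.commute flip: power_mult)

lemmas frob_simps = frob_add frob_minus frob_diff frob_numeral frob_frob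
  power_mult_distrib power_divide

lemma card_field_Suc: "CARD('a) = Suc ((q + 1) * (q - 1))"
  unfolding card_field using q_gt_1
  by (cases q) (auto simp: power2_eq_square)

lemma power_pred_q:
  assumes "(x::'a) ^ q = c * x" "x \<noteq> 0"
  shows "x ^ (q - 1) = c"
proof -
  have "x ^ q = x * x ^ (q - 1)"
    using q_gt_1 by (simp flip: power_Suc)
  then show ?thesis
    using assms by (simp add: mult.commute)
qed

lemma norm_surj:
  assumes "(c::'a) ^ q = c" "c \<noteq> 0"
  obtains z where "z * z ^ q = c"
proof -
  have "\<exists>z. z ^ (q + 1) = c"
    by (rule finite_field_power_residue[OF card_field_Suc]) (use assms power_pred_q[of c 1] in auto)
  then show ?thesis
    using that by auto
qed

text \<open>As \<open>q + 1\<close> is even, the exponent (q^2 - 1)/2 is a multiple of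
  \<open>q - 1\<close>, so it sends every nonzero element of the subfield to 1.\<close>

lemma sqrt_exists:
  assumes "(c::'a) ^ q = c" "c \<noteq> 0"
  obtains r where "r ^ 2 = c"
proof -
  have "q + 1 = 2 * ((q + 1) div 2)"
    using odd_q by simp
  then have "CARD('a) = Suc (2 * (((q + 1) div 2) * (q - 1)))"
    unfolding card_field_Suc by (metis mult.assoc)
  moreover have "(c ^ (q - 1)) ^ ((q + 1) div 2) = 1"
    using assms power_pred_q[of c 1] by simp
  then have "c ^ (((q + 1) div 2) * (q - 1)) = 1"
    by (simp only: mult.commute flip: power_mult)
  ultimately have "\<exists>r. r ^ 2 = c"
    by (rule finite_field_power_residue)
  then show ?thesis
    using that by blast
qed

lemma skew_exists:
  obtains \<epsilon> :: 'a where "\<epsilon> ^ q = - \<epsilon>" "\<epsilon> \<noteq> 0"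
proof -
  have "CARD('a) = Suc ((q - 1) * (q + 1))"
    using card_field_Suc by (simp add: mult.commute)
  \<comment> \<open>By the residue criterion, -1 is then a \<open>(q - 1)\<close>-th power.\<close>
  moreover have "(- 1 :: 'a) ^ (q + 1) = 1"
    using odd_q by simp
  ultimately obtain e :: 'a where e: "e ^ (q - 1) = - 1"
    using finite_field_power_residue by blast
  have "e ^ q = e * e ^ (q - 1)"
    using q_gt_1 by (simp flip: power_Suc)
  then have "e ^ q = - e"
    by (simp only: e mult_minus1_right)
  moreover have "e \<noteq> 0"
    using e q_gt_1 by (auto simp: power_0_left split: if_splits)
  ultimately show ?thesis
    using that by blast
qed

definition F :: "'a \<Rightarrow> 'a \<Rightarrow> 'a" where
  "F \<gamma> x = x + \<gamma> * (x * x ^ q * (x + x ^ q) ^ 2)"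

text \<open>With y = x^q, the argument of the trace is x^3 y + x^2 y^2. Adding its conjugate x y^3 +
  x^2 y^2 gives x y (x + y)^2.\<close>

lemma F_eq_poly:
  "F \<gamma> = poly (monom 1 1 + smult \<gamma> (Tr q (monom 1 (q + 3) + monom 1 (2 * q + 2))))"
proof
  fix x :: 'a
  have expand: "x ^ (q + 3) + x ^ (2 * q + 2) = x ^ q * x ^ 3 + (x ^ q) ^ 2 * x ^ 2"
    by (simp only: power_add power_even_eq)
  have conj: "(x ^ q * x ^ 3 + (x ^ q) ^ 2 * x ^ 2) ^ q = x * (x ^ q) ^ 3 + x ^ 2 * (x ^ q) ^ 2"
    by (simp only: frob_add power_mult_distrib power_commutes_exp[of _ 2 q] power_commutes_exp[of _ 3 q] frob_frob)
  show "F \<gamma> x = poly (monom 1 1 + smult \<gamma> (Tr q (monom 1 (q + 3) + monom 1 (2 * q + 2)))) x"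
    unfolding F_def poly_add poly_smult poly_Tr
    unfolding Tr_def poly_add poly_monom mult_1 expand conj power_one_right
    by algebra
qed

section \<open>Collisions for \<gamma> outside the subfield\<close>

lemma collision_trace_zero:
  assumes "\<gamma> ^ q = - \<gamma>" "\<gamma> \<noteq> 0"
  shows "\<not> inj (F \<gamma>)"
proof
  assume inj: "inj (F \<gamma>)"
  \<comment> \<open>At \<open>1 + t * \<gamma>\<close> the trace is 2 and the norm is 1 - \<gamma>^2
    t^2, so \<open>F\<close> acts on t as t + 4 - 4 \<gamma>^2 t^2. Distinct parameters collide when
    their sum is 1/(4 \<gamma>^2); \<open>k\<close> is half of that.\<close>
  define k where "k = 1 / (8 * \<gamma> ^ 2)"
  have "(8::'a) = 2 ^ 3"
    by simp
  then have "(8::'a) \<noteq> 0"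
    using two_nonzero by (metis power_eq_0_iff)
  then have k: "8 * \<gamma> ^ 2 * k = 1"
    using assms by (simp add: k_def)
  have kq: "k ^ q = k"
    using q_gt_1 by (simp add: k_def frob_simps assms power2_eq_square)
  have "F \<gamma> (1 + (k + 1) * \<gamma>) - F \<gamma> (1 + (k - 1) * \<gamma>) = 2 * \<gamma> * (1 - 8 * \<gamma> ^ 2 * k)"
    unfolding F_def frob_simps assms(1) kq power_one by algebra
  then have "F \<gamma> (1 + (k + 1) * \<gamma>) = F \<gamma> (1 + (k - 1) * \<gamma>)"
    by (simp add: k)
  then have "1 + (k + 1) * \<gamma> = 1 + (k - 1) * \<gamma>"
    by (rule injD[OF inj])
  then have "2 * \<gamma> = 0"
    by algebra
  then show False
    using assms two_nonzero by simp
qed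

text \<open>The points \<open>s * w + \<gamma>\<close> and \<open>s * w - \<gamma>\<close> have
  opposite traces \<open>v\<close> and \<open>- v\<close>, while their norms differ by -2 s w^2. The
  value of \<open>s\<close> makes this difference cancel 2 \<gamma>; the two hypotheses keep
  \<open>v\<close> and \<open>w\<close> nonzero.\<close>

lemma collision_not_in_subfield:
  assumes "\<gamma> ^ q \<noteq> - \<gamma>" "\<gamma> ^ q \<noteq> \<gamma>"
  shows "\<not> inj (F \<gamma>)"
proof
  assume inj: "inj (F \<gamma>)"
  define v w where "v = \<gamma> + \<gamma> ^ q" and "w = \<gamma> - \<gamma> ^ q"
  define s where "s = 1 / (v ^ 2 * w ^ 2)"
  have "v \<noteq> 0" "w \<noteq> 0"
    using assms by (auto simp: v_def w_def add_eq_0_iff)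
  then have s: "s * v ^ 2 * w ^ 2 = 1"
    by (simp add: s_def)
  have vq: "v ^ q = v" and wq: "w ^ q = - w"
    by (simp_all add: v_def w_def frob_simps)
  have sq: "s ^ q = s"
    by (simp add: s_def frob_simps vq wq power2_eq_square)
  have "F \<gamma> (s * w + \<gamma>) - F \<gamma> (s * w - \<gamma>) = 2 * \<gamma> * (1 - s * v ^ 2 * w ^ 2)"
    unfolding F_def frob_simps sq wq unfolding v_def w_def by algebra
  then have "F \<gamma> (s * w + \<gamma>) = F \<gamma> (s * w - \<gamma>)"
    by (simp only: s diff_self mult_zero_right right_minus_eq)
  then have "s * w + \<gamma> = s * w - \<gamma>"
    by (rule injD[OF inj])
  then have "2 * \<gamma> = 0"
    by algebra
  then have "\<gamma> = 0"
    using two_nonzero by simp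
  then show False
    using assms q_gt_1 by simp
qed

section \<open>Collisions for nonzero \<gamma> in the subfield\<close>

lemma F_on_skew_line:
  assumes "\<gamma> ^ q = \<gamma>" "\<eta> ^ q = - \<eta>" "t ^ q = t"
  shows "F \<gamma> (\<eta> + \<gamma> * t) = \<eta> + \<gamma> * (t + 4 * \<gamma> ^ 2 * t ^ 2 * (\<gamma> ^ 2 * t ^ 2 - \<eta> ^ 2))"
  unfolding F_def frob_simps assms by algebra

text \<open>Two parameters t and u on the skew line are prescribed by their sum \<open>w\<close>,
  which is 1 or -1, and their difference \<open>\<tau>\<close>. Then t^2 + u^2 = (1 + \<tau>^2)/2,
  and \<open>form\<close> is \<open>w\<close> times the vanishing of the difference
  quotient.\<close>

lemma collision_from_quadratic_form:
  assumes "\<gamma> ^ q = \<gamma>" "\<gamma> \<noteq> 0" "\<eta> ^ q = - \<eta>" "\<tau> ^ q = \<tau>" "\<tau> \<noteq> 0"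
    and w: "w ^ q = w" "w ^ 2 = 1"
    and form: "2 * \<gamma> ^ 4 * (1 + \<tau> ^ 2) - 4 * \<gamma> ^ 2 * \<eta> ^ 2 + w = 0"
  shows "\<not> inj (F \<gamma>)"
proof
  assume inj: "inj (F \<gamma>)"
  define h :: 'a where "h = 1 / 2"
  have h: "2 * h = 1"
    using two_nonzero by (simp add: h_def)
  have hq: "h ^ q = h"
    by (simp add: h_def frob_simps)
  define t u where "t = (w + \<tau>) * h" and "u = (w - \<tau>) * h"
  have tq: "t ^ q = t" and uq: "u ^ q = u"
    by (simp_all add: t_def u_def frob_simps w hq assms)
  have "t + u = 2 * h * w" "t ^ 2 + u ^ 2 = 2 * h * (h * (w ^ 2 + \<tau> ^ 2))"
    unfolding t_def u_def by algebra+
  then have sum: "t + u = w" and squares: "t ^ 2 + u ^ 2 = h * (1 + \<tau> ^ 2)"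
    by (simp_all only: h w(2) mult_1)
  have "1 + 4 * \<gamma> ^ 2 * w * (\<gamma> ^ 2 * (h * (1 + \<tau> ^ 2)) - \<eta> ^ 2) = 0"
    using h form w(2) by algebra
  moreover have "F \<gamma> (\<eta> + \<gamma> * t) - F \<gamma> (\<eta> + \<gamma> * u) =
      \<gamma> * (t - u) * (1 + 4 * \<gamma> ^ 2 * (t + u) * (\<gamma> ^ 2 * (t ^ 2 + u ^ 2) - \<eta> ^ 2))"
    unfolding F_on_skew_line[OF assms(1,3) tq] F_on_skew_line[OF assms(1,3) uq] by algebra
  ultimately have "F \<gamma> (\<eta> + \<gamma> * t) = F \<gamma> (\<eta> + \<gamma> * u)"
    by (simp add: sum squares)
  then have "\<eta> + \<gamma> * t = \<eta> + \<gamma> * u"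
    by (rule injD[OF inj])
  moreover have "\<eta> + \<gamma> * t - (\<eta> + \<gamma> * u) = \<gamma> * \<tau> * (2 * h)"
    unfolding t_def u_def by algebra
  ultimately have "\<gamma> * \<tau> = 0"
    by (simp only: h diff_self mult_1_right)
  then show False
    using assms by simp
qed

text \<open>Since 1 and -1 differ, at least one sign avoids the single bad value. This freedom later
  excludes degenerate witnesses.\<close>

lemma sign_avoiding:
  fixes c :: 'a
  obtains w :: 'a where "w ^ q = w" "w ^ 2 = 1" "c * w \<noteq> 1"
proof (cases "c = 1")
  case True
  then have "c * (- 1) \<noteq> 1"
    using two_nonzero by (metis add.right_inverse mult_1 one_add_one)
  then show ?thesis
    using that[of "- 1"] by (simp add: frob_minus)
qed (use that[of 1] in simp)

lemma norm_surj_trace_nonzero: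
  assumes "(c::'a) ^ q = c" "c \<noteq> 0"
  obtains z where "z * z ^ q = c" "z + z ^ q \<noteq> 0"
proof -
  obtain z where z: "z * z ^ q = c"
    using norm_surj assms by blast
  show ?thesis
  proof (cases "z + z ^ q = 0")
    case True
    then have zq: "z ^ q = - z"
      by (simp add: add_eq_0_iff)
    obtain \<epsilon> :: 'a where \<epsilon>: "\<epsilon> ^ q = - \<epsilon>" "\<epsilon> \<noteq> 0"
      using skew_exists by blast
    have "4 * \<epsilon> \<noteq> 0"
      using two_nonzero \<epsilon>(2) by (metis mult_eq_0_iff mult_2 numeral_Bit0)
    have ne: "1 + \<epsilon> \<noteq> 0" "1 - \<epsilon> \<noteq> 0"
    proof -
      have "\<epsilon> ^ q \<noteq> \<epsilon>"
        using \<epsilon> two_nonzero by (metis add_eq_0_iff mult_2 mult_eq_0_iff)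
      then show "1 + \<epsilon> \<noteq> 0" "1 - \<epsilon> \<noteq> 0"
        by (auto simp: frob_minus add_eq_0_iff)
    qed
    \<comment> \<open>A Cayley transform: conjugation inverts \<open>u\<close>, so it has norm 1 and
      multiplying \<open>z\<close> by it preserves the norm. The trace becomes
      \<open>z * (u - u ^ q)\<close>.\<close>
    define u where "u = (1 + \<epsilon>) / (1 - \<epsilon>)"
    have u: "u * (1 - \<epsilon>) = 1 + \<epsilon>" and uq: "u ^ q * (1 + \<epsilon>) = 1 - \<epsilon>"
      using ne by (simp_all add: u_def frob_simps \<epsilon>)
    have norm_u: "u * u ^ q = 1"
      using ne by (simp add: u_def frob_simps \<epsilon>)
    have "u - u ^ q \<noteq> 0"
    proof
      assume "u - u ^ q = 0"
      then have "u * (1 + \<epsilon>) = 1 - \<epsilon>"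
        using uq by simp
      \<comment> \<open>This combination of the two linear relations for \<open>u\<close> eliminates
        \<open>u\<close>.\<close>
      moreover have "4 * \<epsilon> = (1 + \<epsilon> - u * (1 - \<epsilon>)) * (1 + \<epsilon>) - (1 - \<epsilon> - u * (1 + \<epsilon>)) * (1 - \<epsilon>)"
        by algebra
      ultimately have "4 * \<epsilon> = 0"
        by (simp add: u)
      with \<open>4 * \<epsilon> \<noteq> 0\<close> show False ..
    qed
    moreover have "z * u + (z * u) ^ q = z * (u - u ^ q)"
      by (simp add: frob_simps zq algebra_simps)
    moreover have "z \<noteq> 0"
      using z assms by auto
    moreover have "z * u * (z * u) ^ q = c"
    proof -
      have "z * u * (z * u) ^ q = (z * z ^ q) * (u * u ^ q)"
        by (simp add: power_mult_distrib mult_ac)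
      then show ?thesis
        by (simp only: z norm_u mult_1_right)
    qed
    ultimately show ?thesis
      using that[of "z * u"] by simp
  qed (use z that in blast)
qed

text \<open>With \<open>c\<close> defined by 2 \<gamma>^4 + 4 \<gamma>^2 c + w = 0, the equation
  \<open>form\<close> becomes (\<gamma> \<tau>)^2 - 2 \<eta>^2 = 2 c. The cases are whether a square
  root \<open>r\<close> of 2 is skew or lies in the subfield.\<close>

lemma collision_in_subfield:
  assumes \<gamma>: "\<gamma> ^ q = \<gamma>" "\<gamma> \<noteq> (0::'a)"
  shows "\<not> inj (F \<gamma>)"
proof -
  obtain r :: 'a where r: "r ^ 2 = 2"
    using sqrt_exists[of 2] two_nonzero frob_numeral by blast
  have "(r ^ q) ^ 2 = r ^ 2"
    by (simp only: power_commutes_exp[of r q 2] r frob_numeral)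
  then have "r ^ q = r \<or> r ^ q = - r"
    by (simp add: power2_eq_iff)
  define h g :: 'a where "h = 1 / 2" and "g = 1 / \<gamma>"
  have h: "2 * h = 1" and g: "\<gamma> * g = 1"
    using two_nonzero \<gamma> by (simp_all add: h_def g_def)
  have hq: "h ^ q = h" and gq: "g ^ q = g"
    by (simp_all add: h_def g_def frob_simps \<gamma>)
  from \<open>r ^ q = r \<or> r ^ q = - r\<close> show ?thesis
  proof
    assume rq: "r ^ q = - r"
    \<comment> \<open>The excluded value is the one for which 1 + 2 c = 0, which would force
      \<open>\<tau> = 0\<close>.\<close>
    obtain w :: 'a where w: "w ^ q = w" "w ^ 2 = 1" "2 * \<gamma> ^ 2 * (1 - \<gamma> ^ 2) * w \<noteq> 1"
      using sign_avoiding by blast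
    define c where "c = - (w * h ^ 2 * g ^ 2) - \<gamma> ^ 2 * h"
    have c: "2 * \<gamma> ^ 4 + 4 * \<gamma> ^ 2 * c + w = 0"
      unfolding c_def using h g by algebra
    have cq: "c ^ q = c"
      unfolding c_def by (simp add: frob_simps hq gq w \<gamma> power2_eq_square)
    \<comment> \<open>Writing \<eta> = b r turns the form into (\<gamma> \<tau> - 2 b)(\<gamma>
      \<tau> + 2 b) = 2 c. The witnesses solve for the factors w and 2 c w.\<close>
    define \<tau> \<eta> where "\<tau> = (w + 2 * c * w) * h * g" and "\<eta> = (2 * c * w - w) * h ^ 2 * r"
    have "\<tau> \<noteq> 0"
    proof
      assume "\<tau> = 0"
      moreover have "2 * \<gamma> * \<tau> * w = 1 + 2 * c"
        unfolding \<tau>_def using g h w(2) by algebra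
      ultimately have "1 + 2 * c = 0"
        by simp
      then have "2 * \<gamma> ^ 2 * (1 - \<gamma> ^ 2) * w = 1"
        using c w(2) by algebra
      with w(3) show False ..
    qed
    moreover have "\<tau> ^ q = \<tau>" "\<eta> ^ q = - \<eta>"
      by (simp_all add: \<tau>_def \<eta>_def frob_simps hq gq w cq rq power2_eq_square)
    moreover have "2 * \<gamma> ^ 4 * (1 + \<tau> ^ 2) - 4 * \<gamma> ^ 2 * \<eta> ^ 2 + w = 0"
    proof -
      have "(\<gamma> * \<tau>) ^ 2 = ((1 + 2 * c) * h) ^ 2"
        unfolding \<tau>_def using g w(2) by algebra
      moreover have "\<eta> ^ 2 = 2 * ((2 * c - 1) * h ^ 2) ^ 2"
      proof -
        have "\<eta> ^ 2 = ((2 * c - 1) * h ^ 2) ^ 2 * w ^ 2 * r ^ 2"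
          unfolding \<eta>_def by algebra
        then show ?thesis
          by (simp add: r w(2))
      qed
      ultimately show ?thesis
        using c h by algebra
    qed
    ultimately show ?thesis
      using collision_from_quadratic_form \<gamma> w(1,2) by blast
  next
    assume rq: "r ^ q = r"
    \<comment> \<open>Here the excluded value is the one that would give
      \<open>c = 0\<close>.\<close>
    obtain w :: 'a where w: "w ^ q = w" "w ^ 2 = 1" "- 2 * \<gamma> ^ 4 * w \<noteq> 1"
      using sign_avoiding by blast
    define c where "c = - (w * h ^ 2 * g ^ 2) - \<gamma> ^ 2 * h"
    have c: "2 * \<gamma> ^ 4 + 4 * \<gamma> ^ 2 * c + w = 0"
      unfolding c_def using h g by algebra
    have cq: "c ^ q = c"
      unfolding c_def by (simp add: frob_simps hq gq w \<gamma> power2_eq_square)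
    have "c \<noteq> 0"
    proof
      assume "c = 0"
      then have "- 2 * \<gamma> ^ 4 * w = 1"
        using c w(2) by algebra
      with w(3) show False ..
    qed
    obtain z where z: "z * z ^ q = c" "z + z ^ q \<noteq> 0"
      using norm_surj_trace_nonzero cq \<open>c \<noteq> 0\<close> by blast
    \<comment> \<open>Writing \<gamma> \<tau> = r a reduces the form to a^2 - \<eta>^2 = c, the norm
      equation for a + \<eta>. So a and \<eta> are the subfield and skew parts of \<open>z\<close>,
      and a nonzero trace gives a nonzero \<open>\<tau>\<close>.\<close>
    define \<tau> \<eta> where "\<tau> = r * (z + z ^ q) * h * g" and "\<eta> = (z - z ^ q) * h"
    have "r \<noteq> 0" "h \<noteq> 0" "g \<noteq> 0"
      using r h g two_nonzero by auto
    then have "\<tau> \<noteq> 0"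
      using z(2) by (simp add: \<tau>_def)
    moreover have "\<tau> ^ q = \<tau>" "\<eta> ^ q = - \<eta>"
      by (simp_all add: \<tau>_def \<eta>_def frob_simps hq gq rq algebra_simps)
    moreover have "2 * \<gamma> ^ 4 * (1 + \<tau> ^ 2) - 4 * \<gamma> ^ 2 * \<eta> ^ 2 + w = 0"
    proof -
      have "(\<gamma> * \<tau>) ^ 2 = r ^ 2 * (\<gamma> * g) ^ 2 * ((z + z ^ q) * h) ^ 2"
        unfolding \<tau>_def by algebra
      then have \<tau>2: "(\<gamma> * \<tau>) ^ 2 = 2 * ((z + z ^ q) * h) ^ 2"
        by (simp only: r g power_one mult_1_right)
      have "2 * \<gamma> ^ 4 * (1 + \<tau> ^ 2) - 4 * \<gamma> ^ 2 * \<eta> ^ 2 + w =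
          2 * \<gamma> ^ 4 + 2 * \<gamma> ^ 2 * (\<gamma> * \<tau>) ^ 2 - 4 * \<gamma> ^ 2 * \<eta> ^ 2 + w"
        by algebra
      also have "\<dots> = 2 * \<gamma> ^ 4 + 4 * \<gamma> ^ 2 * (z * z ^ q) * (2 * h) ^ 2 + w"
        unfolding \<tau>2 \<eta>_def by algebra
      also have "\<dots> = 0"
        by (simp only: z(1) h power_one mult_1_right c)
      finally show ?thesis .
    qed
    ultimately show ?thesis
      using collision_from_quadratic_form \<gamma> w(1,2) by blast
  qed
qed

lemma inj_F_iff: "inj (F \<gamma>) \<longleftrightarrow> \<gamma> = 0"
proof
  assume "inj (F \<gamma>)"
  then show "\<gamma> = 0"
    using collision_trace_zero collision_not_in_subfield collision_in_subfield by metis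
qed (simp add: F_def inj_def)

end

theorem corollary3p3:
  fixes q :: nat and \<gamma> :: "'a::finite_field"
  assumes "primepow q" and "odd q"
    and "CARD('a) = q ^ 2"
  shows "permutation_poly
           (monom 1 1 + smult \<gamma> (Tr q (monom 1 (q + 3) + monom 1 (2 * q + 2))))
         \<longleftrightarrow> \<gamma> = 0"
proof -
  interpret odd_quadratic_field q "TYPE('a)"
    by unfold_locales (fact assms)+
  have "bij (F \<gamma>) \<longleftrightarrow> inj (F \<gamma>)"
    by (auto simp: bij_def finite_UNIV_inj_surj)
  then show ?thesis
    unfolding permutation_poly_def F_eq_poly[symmetric] by (simp add: inj_F_iff)
qed

end
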